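(* Let $m$ be a positive integer, let $n\in\{2m,2m+1\}$, and let $F(x)=x^{2^{m+1}-1}$ be the power mapping on $\mathbb{F}_{2^n}$. Then the Feistel boomerang differential uniformity of $F$ satisfies $$\beta_d(F)=\begin{cases}2^m,&\text{if }n=2m;\\ 2,&\text{if }n=2m+1.\end{cases}$$
   Context: $\mathbb{F}_{2^n}$ is the finite field with $2^n$ elements. For a mapping $F:\mathbb{F}_{2^n}\to\mathbb{F}_{2^n}$ and $(a,c,b)\in\mathbb{F}_{2^n}^3$, the Feistel Boomerang Difference Table (FBDT) entry is $$\mathrm{FBDT}_F(a,c,b)=|\{x\in\mathbb{F}_{2^n}: F(x)+F(x+a)+F(x+b)+F(x+a+b)=0,\ F(x)+F(x+a)=c\}|.$$ The Feistel boomerang differential uniformity of $F$ is $$\beta_d(F)=\max_{(a,c,b)\in\mathbb{F}_{2^n}^3,\ (a,c)\neq(0,0)}\mathrm{FBDT}_F(a,c,b).$$ *)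

theory Defs
  imports "HOL-Computational_Algebra.Computational_Algebra" "HOL-Library.Cardinality"
begin

definition FBDT :: "('a::{field,finite} \<Rightarrow> 'a) \<Rightarrow> 'a \<Rightarrow> 'a \<Rightarrow> 'a \<Rightarrow> nat" where
  "FBDT F a c b =
     card {x. F x + F (x + a) + F (x + b) + F (x + a + b) = 0 \<and> F x + F (x + a) = c}"

definition feistel_boomerang_uniformity :: "('a::{field,finite} \<Rightarrow> 'a) \<Rightarrow> nat" where
  "feistel_boomerang_uniformity F = Max {FBDT F a c b |a c b. (a, c) \<noteq> (0, 0)}"

end

theory Submission
  imports Defs
begin

text \<open>
  Taking \<open>b = 0\<close> makes the second-order condition void, so the uniformity is the ordinary
  differential uniformity, and for a power map only the direction \<open>a = 1\<close> matters.
  Put \<open>q = 2 ^ (m + 1)\<close>. Multiplying \<open>x ^ (q - 1) + (x + 1) ^ (q - 1) = c\<close> by \<open>x * (x + 1)\<close>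
  gives the linearized equation \<open>x ^ q = c * x\<^sup>2 + (c + 1) * x\<close>. For \<open>c = 1\<close> it says that \<open>x\<close> is
  fixed by the \<open>m\<close>-th iterate of the Frobenius map. For \<open>c \<noteq> 1\<close>, raising it to the power \<open>q\<close> and
  using that \<open>x ^ (q * q)\<close> is \<open>x ^ 4\<close> or \<open>x\<^sup>2\<close> gives a nonzero polynomial equation of degree at
  most 4, two of whose roots are the spurious solutions \<open>0\<close> and \<open>1\<close>.
\<close>

section \<open>Finite fields and characteristic 2\<close>

text \<open>Multiplication by a nonzero \<open>x\<close> permutes the nonzero elements, so it leaves
  their product unchanged.\<close>

lemma power_CARD_eq_self:
  fixes x :: "'a::{field,finite}"
  shows "x ^ CARD('a) = x"
proof (cases "x = 0")
  case False
  have "(\<Prod>y\<in>-{0}. y) = (\<Prod>y\<in>-{0}. x * y)"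
    by (rule prod.reindex_bij_witness[of _ "\<lambda>y. x * y" "\<lambda>y. y / x"]) (use False in auto)
  also have "\<dots> = x ^ card (-{0::'a}) * (\<Prod>y\<in>-{0}. y)"
    by (simp add: prod.distrib)
  finally have "x ^ card (-{0::'a}) = 1"
    by simp
  moreover have "CARD('a) = Suc (card (-{0::'a}))"
    using card_Suc_Diff1[of UNIV "0::'a"] by (simp add: Compl_eq_Diff_UNIV)
  ultimately show ?thesis
    by simp
qed (simp add: zero_power)

lemma CHAR_eq_2:
  assumes "CARD('a::{field,finite}) = 2 ^ n" "n > 0"
  shows "CHAR('a) = 2"
proof -
  have "(- 1 :: 'a) = (- 1) ^ 2 ^ n"
    using power_CARD_eq_self[of "-1 :: 'a"] assms by simp
  also have "\<dots> = 1"
    using assms by simp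
  finally have "(1::'a) + 1 = 0"
    by (metis add.right_inverse)
  hence "of_nat 2 = (0::'a)"
    by simp
  hence "CHAR('a) dvd 2"
    using of_nat_eq_0_iff_char_dvd by blast
  thus ?thesis
    using two_is_prime_nat CHAR_not_1'[where 'a = 'a] by (auto simp: prime_nat_iff)
qed

context
  assumes char2: "CHAR('a::field) = 2"
begin

lemma add_self_char2: "x + x = (0::'a)"
  by (metis uminus_CHAR_2[OF char2] add.right_inverse)

lemma add_cancel_char2: "x + (x + y) = (y::'a)"
  by (metis add_self_char2 add.assoc add_0)

lemma add_eq_0_iff_char2: "x + y = 0 \<longleftrightarrow> x = (y::'a)"
  by (metis add_self_char2 add_cancel_char2 add.right_neutral)

lemma frobenius_add: "(x + y :: 'a) ^ 2 ^ k = x ^ 2 ^ k + y ^ 2 ^ k"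
  using freshmans_dream'[where 'a = 'a, of "2 ^ k" k] by (simp add: char2)

text \<open>An iterate of Frobenius is additive with trivial kernel.\<close>

lemma frobenius_inj: "x ^ 2 ^ k = y ^ 2 ^ k \<longleftrightarrow> x = (y::'a)"
  by (metis frobenius_add add_eq_0_iff_char2 power_eq_0_iff zero_less_power zero_less_numeral
      zero_power)

section \<open>Fibres of the derivative in direction 1\<close>

lemma card_linearized_roots_le_4:
  assumes q: "q = 2 ^ k" and r: "r = 2 \<or> r = 4" and frob: "\<And>x::'a. x ^ (q * q) = x ^ r"
    and c: "c \<noteq> (1::'a)"
  shows "finite {x. x ^ q = c * x\<^sup>2 + (c + 1) * x}" "card {x. x ^ q = c * x\<^sup>2 + (c + 1) * x} \<le> 4"
proof -
  define d where "d = c ^ q"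
  \<comment> \<open>Raising the equation to the power \<open>q\<close> gives
    \<open>x ^ r = d * (x ^ q)\<^sup>2 + (d + 1) * x ^ q\<close>. Substituting the equation for
    \<open>x ^ q\<close> once more yields \<open>p\<close>. As \<open>r \<ge> 2\<close>, the added
    monomial cannot cancel the linear coefficient \<open>(d + 1) * (c + 1)\<close>.\<close>
  define p where
    "p = [:0, (d + 1) * (c + 1), d * (c + 1)\<^sup>2 + (d + 1) * c, 0, d * c\<^sup>2:] + monom 1 r"
  have "d \<noteq> 1"
    using frobenius_inj[of c k 1] c by (simp add: d_def q)
  hence "coeff p 1 \<noteq> 0"
    using r c by (auto simp: p_def add_eq_0_iff_char2)
  hence "p \<noteq> 0"
    by auto
  have deg: "degree p \<le> 4"
    unfolding p_def using r by (intro degree_add_le) (auto simp: degree_monom_eq)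
  have root: "poly p x = 0" if x: "x ^ q = c * x\<^sup>2 + (c + 1) * x" for x
  proof -
    let ?z = "c * x\<^sup>2 + (c + 1) * x"
    have sq: "(u + v)\<^sup>2 = u\<^sup>2 + v\<^sup>2" for u v :: 'a
      using frobenius_add[of u v 1] by simp
    have "x ^ r = ?z ^ q"
      by (metis frob power_mult x)
    also have "\<dots> = d * (x ^ q)\<^sup>2 + (d + 1) * x ^ q"
      by (simp add: q frobenius_add power_mult_distrib d_def flip: power_mult)
        (simp add: mult.commute)
    also have "\<dots> = d * (c\<^sup>2 * x ^ 4 + (c + 1)\<^sup>2 * x\<^sup>2) + (d + 1) * ?z"
      by (simp add: x sq power_mult_distrib flip: power_mult)
    also have "\<dots> = poly (p - monom 1 r) x"
      by (simp add: p_def algebra_simps power2_eq_square power4_eq_xxxx)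
    finally show ?thesis
      by (metis poly_diff diff_eq_eq poly_monom mult_1 add_self_char2)
  qed
  hence sub: "{x. x ^ q = c * x\<^sup>2 + (c + 1) * x} \<subseteq> {x. poly p x = 0}"
    by blast
  show "finite {x. x ^ q = c * x\<^sup>2 + (c + 1) * x}"
    using finite_subset[OF sub] poly_roots_finite[OF \<open>p \<noteq> 0\<close>] by simp
  show "card {x. x ^ q = c * x\<^sup>2 + (c + 1) * x} \<le> 4"
    using card_mono[OF poly_roots_finite[OF \<open>p \<noteq> 0\<close>] sub] card_poly_roots_bound[OF \<open>p \<noteq> 0\<close>] deg
    by linarith
qed

text \<open>After multiplication by the nonzero \<open>x * (x + 1)\<close>, the two mixed terms
  \<open>x * x ^ q\<close> cancel in characteristic 2.\<close>

lemma derivative_eq_iff: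
  assumes q: "q = 2 ^ k" "k > 0" and x: "x \<noteq> 0" "x \<noteq> (1::'a)"
  shows "x ^ (q - 1) + (x + 1) ^ (q - 1) = c \<longleftrightarrow> x ^ q = c * x\<^sup>2 + (c + 1) * x"
proof -
  have nz: "x * (x + 1) \<noteq> 0"
    using x by (simp add: add_eq_0_iff_char2)
  have pow: "y * y ^ (q - 1) = y ^ q" for y :: 'a
    using q by (simp flip: power_Suc)
  have "x * (x + 1) * (x ^ (q - 1) + (x + 1) ^ (q - 1)) = (x + 1) * x ^ q + x * (x + 1) ^ q"
    unfolding pow[symmetric] by (simp add: algebra_simps)
  also have "\<dots> = x ^ q + x + (x * x ^ q + x * x ^ q)"
    by (simp add: q frobenius_add algebra_simps)
  also have "\<dots> = x ^ q + x"
    by (simp add: add_self_char2)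
  finally have "x ^ (q - 1) + (x + 1) ^ (q - 1) = c \<longleftrightarrow> x ^ q + x = x * (x + 1) * c"
    using nz by (metis mult_left_cancel)
  also have "\<dots> \<longleftrightarrow> x ^ q = x * (x + 1) * c + x"
    by (metis add_cancel_char2 add.commute)
  also have "x * (x + 1) * c + x = c * x\<^sup>2 + (c + 1) * x"
    by (simp add: algebra_simps power2_eq_square)
  finally show ?thesis .
qed

lemma derivative_fibre_1:
  assumes "m > 0"
  shows "{x::'a. x ^ (2 ^ (m + 1) - 1) + (x + 1) ^ (2 ^ (m + 1) - 1) = 1} = {x. x ^ 2 ^ m = x}"
    (is "?D = _")
proof -
  define q :: nat where "q = 2 ^ (m + 1)"
  have q1: "q - 1 > 0"
    using power_gt1[of "2::nat" m] by (simp add: q_def)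
  have "x \<in> ?D \<longleftrightarrow> x ^ 2 ^ m = x" for x :: 'a
  \<comment> \<open>The points 0 and 1, where clearing denominators fails, lie in both sets.
    Elsewhere the linearized equation \<open>x ^ q = x\<^sup>2\<close> is the square of the
    fixed-point equation.\<close>
  proof (cases "x = 0 \<or> x = 1")
    case True
    have "x ^ (q - 1) + (x + 1) ^ (q - 1) = 1"
      using True add_self_char2[of 1] q1 by (auto simp: zero_power)
    hence "x \<in> ?D"
      by (simp add: q_def)
    thus ?thesis
      using True by (auto simp: zero_power)
  next
    case False
    hence "x \<in> ?D \<longleftrightarrow> x ^ q = x\<^sup>2"
      using derivative_eq_iff[of q "m + 1" x 1] add_self_char2[of 1] by (simp add: q_def)
    also have "x ^ q = (x ^ 2 ^ m) ^ 2 ^ 1"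
      by (simp add: q_def mult.commute flip: power_mult)
    also have "\<dots> = x\<^sup>2 \<longleftrightarrow> x ^ 2 ^ m = x"
      using frobenius_inj[of "x ^ 2 ^ m" 1 x] by simp
    finally show ?thesis .
  qed
  thus ?thesis
    by blast
qed

lemma card_derivative_fibre_le_2:
  assumes q: "q = 2 ^ k" "k > 0" and r: "r = 2 \<or> r = 4" and frob: "\<And>x::'a. x ^ (q * q) = x ^ r"
    and c: "c \<noteq> (1::'a)"
  shows "card {x. x ^ (q - 1) + (x + 1) ^ (q - 1) = c} \<le> 2"
proof -
  let ?L = "{x. x ^ q = c * x\<^sup>2 + (c + 1) * x}"
  have "q \<ge> 2"
    using q by (cases k) auto
  note L = card_linearized_roots_le_4[OF q(1) r frob c]
  have "x \<in> ?L - {0, 1}" if x: "x ^ (q - 1) + (x + 1) ^ (q - 1) = c" for x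
  proof -
    have "x \<noteq> 0" "x \<noteq> 1"
      using x c add_self_char2[of 1] \<open>q \<ge> 2\<close> by (auto simp: zero_power)
    thus ?thesis
      using derivative_eq_iff[OF q, of x c] x by blast
  qed
  hence "{x. x ^ (q - 1) + (x + 1) ^ (q - 1) = c} \<subseteq> ?L - {0, 1}"
    by blast
  hence "card {x. x ^ (q - 1) + (x + 1) ^ (q - 1) = c} \<le> card (?L - {0, 1})"
    using L(1) by (intro card_mono) auto
  also have "{0, 1} \<subseteq> ?L"
    using \<open>q \<ge> 2\<close> by (auto simp: zero_power add_cancel_char2)
  hence "card (?L - {0, 1}) = card ?L - 2"
    by (subst card_Diff_subset) auto
  also have "\<dots> \<le> 2"
    using L(2) by simp
  finally show ?thesis .
qed

end

section \<open>Fixed points of the \<open>m\<close>-th Frobenius iterate\<close>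

lemma card_frobenius_fixed_half:
  assumes card: "CARD('a::{field,finite}) = 2 ^ (2 * m)" and "m > 0"
  shows "card {x::'a. x ^ 2 ^ m = x} = 2 ^ m"
proof (rule antisym)
  let ?K = "{x::'a. x ^ 2 ^ m = x}"
  have char2: "CHAR('a) = 2"
    using CHAR_eq_2[OF card] \<open>m > 0\<close> by simp
  have gt: "(2::nat) ^ m > 1"
    using \<open>m > 0\<close> by (intro one_less_power) auto
  define p where "p = monom (1::'a) (2 ^ m) - monom 1 1"
  have "coeff p (2 ^ m) = 1"
    using gt by (simp add: p_def)
  hence "p \<noteq> 0"
    by auto
  have "?K = {x. poly p x = 0}"
    by (simp add: p_def poly_monom)
  also have "card \<dots> \<le> degree p"
    using \<open>p \<noteq> 0\<close> by (rule card_poly_roots_bound)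
  also have "\<dots> \<le> 2 ^ m"
    unfolding p_def using gt by (intro degree_diff_le) (auto simp: degree_monom_eq)
  finally show "card ?K \<le> 2 ^ m" .
  \<comment> \<open>The additive map \<open>f\<close> has kernel \<open>?K\<close> and takes values in \<open>?K\<close>, hence \<open>card ?K ^ 2\<close> is at
    least the number of elements of the field.\<close>
  define f where "f = (\<lambda>x::'a. x ^ 2 ^ m + x)"
  \<comment> \<open>Two applications of the \<open>m\<close>-th iterate give the identity, so it
    swaps the two summands of \<open>f x\<close>.\<close>
  have fK: "f x \<in> ?K" for x
  proof -
    have "(x ^ 2 ^ m) ^ 2 ^ m = x ^ CARD('a)"
      by (simp add: card mult_2 power_add power_mult)
    thus ?thesis
      by (simp add: f_def frobenius_add[OF char2] power_CARD_eq_self add.commute)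
  qed
  \<comment> \<open>Translation by one solution \<open>x0\<close> injects a nonempty fibre into the
    kernel.\<close>
  have fibre: "card {x. f x = y} \<le> card ?K" for y
  proof (cases "\<exists>x0. f x0 = y")
    case True
    then obtain x0 where x0: "f x0 = y" ..
    have add: "f (x + x0) = f x + f x0" for x
      by (simp add: f_def frobenius_add[OF char2] algebra_simps)
    have "x + x0 \<in> ?K" if "f x = y" for x
    proof -
      have "f (x + x0) = 0"
        using that x0 add add_self_char2[OF char2] by simp
      thus ?thesis
        by (simp add: f_def add_eq_0_iff_char2[OF char2])
    qed
    thus ?thesis
      by (intro card_inj_on_le[of "\<lambda>x. x + x0"]) (auto simp: inj_on_def)
  qed simp
  have "2 ^ m * 2 ^ m = CARD('a)"
    by (simp add: card mult_2 power_add)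
  also have "(UNIV :: 'a set) = (\<Union>y\<in>?K. {x. f x = y})"
    using fK by auto
  also have "card \<dots> \<le> (\<Sum>y\<in>?K. card {x. f x = y})"
    by (rule card_UN_le) simp
  also have "\<dots> \<le> card ?K * card ?K"
    using sum_bounded_above[of ?K "\<lambda>y. card {x. f x = y}"] fibre by simp
  finally show "2 ^ m \<le> card ?K"
    using power2_nat_le_eq_le[of "2 ^ m" "card ?K"] by (simp add: power2_eq_square)
qed

text \<open>Frobenius iterated \<open>2 * m + 1\<close> times is the identity, but on a point fixed
  by the \<open>m\<close>-th iterate it is just squaring.\<close>

lemma card_frobenius_fixed_odd:
  assumes card: "CARD('a::{field,finite}) = 2 ^ (2 * m + 1)"
  shows "card {x::'a. x ^ 2 ^ m = x} = 2"
proof -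
  have "x = 0 \<or> x = 1" if "x ^ 2 ^ m = x" for x :: 'a
  proof -
    have "x = ((x ^ 2 ^ m) ^ 2 ^ m)\<^sup>2"
      using power_CARD_eq_self[of x] unfolding card by (simp add: mult_2 power_add power_mult power2_eq_square)
    hence "x * x = x"
      by (simp add: that power2_eq_square)
    thus ?thesis
      by simp
  qed
  hence "{x::'a. x ^ 2 ^ m = x} = {0, 1}"
    by (auto simp: zero_power)
  thus ?thesis
    by simp
qed

section \<open>Reduction to \<open>b = 0\<close> and \<open>a = 1\<close>\<close>

lemma FBDT_zero_right:
  assumes "CHAR('a::{field,finite}) = 2"
  shows "FBDT F a c (0::'a) = card {x. F x + F (x + a) = c}"
proof -
  have "F x + F (x + a) + F (x + 0) + F (x + a + 0) = 0" for x
    using add_self_char2[OF assms, of "F x + F (x + a)"] by (simp add: add_ac)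
  thus ?thesis
    by (simp add: FBDT_def)
qed

lemma FBDT_le_zero_right:
  assumes "CHAR('a::{field,finite}) = 2"
  shows "FBDT F a c b \<le> FBDT F a c (0::'a)"
  unfolding FBDT_zero_right[OF assms] unfolding FBDT_def by (rule card_mono) auto

text \<open>The substitution \<open>x = a * y\<close> pulls the factor \<open>a ^ d\<close> out of
  the derivative.\<close>

lemma card_power_derivative_fibre:
  fixes a c :: "'a::{field,finite}"
  assumes "a \<noteq> 0"
  shows "card {x. x ^ d + (x + a) ^ d = c} = card {x. x ^ d + (x + 1) ^ d = c / a ^ d}"
proof (rule bij_betw_same_card, rule bij_betw_byWitness[of _ "\<lambda>x. a * x"])
  have eq: "(a * x) ^ d + (a * x + a) ^ d = a ^ d * (x ^ d + (x + 1) ^ d)" for x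
    by (simp add: distrib_left flip: power_mult_distrib)
  show "(*) a ` {x. x ^ d + (x + 1) ^ d = c / a ^ d} \<subseteq> {x. x ^ d + (x + a) ^ d = c}"
    using assms by (auto simp: eq)
  have "x ^ d + (x + a) ^ d = a ^ d * ((x / a) ^ d + (x / a + 1) ^ d)" for x
    using eq[of "x / a"] assms by simp
  thus "(\<lambda>x. x / a) ` {x. x ^ d + (x + a) ^ d = c} \<subseteq> {x. x ^ d + (x + 1) ^ d = c / a ^ d}"
    using assms by auto
qed (use assms in auto)

theorem corollary2:
  fixes m n :: nat and F :: "'a::{field,finite} \<Rightarrow> 'a"
  assumes "m > 0"
    and "n = 2 * m \<or> n = 2 * m + 1"
    and "CARD('a) = 2 ^ n"
    and "F = (\<lambda>x. x ^ (2 ^ (m + 1) - 1))"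
  shows "feistel_boomerang_uniformity F = (if n = 2 * m then 2 ^ m else 2)"
proof -
  define q :: nat where "q = 2 ^ (m + 1)"
  define N :: nat where "N = (if n = 2 * m then 2 ^ m else 2)"
  define D where "D = (\<lambda>c::'a. {x. x ^ (q - 1) + (x + 1) ^ (q - 1) = c})"
  have F: "F = (\<lambda>x. x ^ (q - 1))"
    using assms by (simp add: q_def)
  have char2: "CHAR('a) = 2"
    using CHAR_eq_2 assms by auto
  have D1: "card (D 1) = N"
    using derivative_fibre_1[OF char2 \<open>m > 0\<close>] card_frobenius_fixed_half[where 'a = 'a, of m]
      card_frobenius_fixed_odd[where 'a = 'a, of m] assms by (auto simp: D_def q_def N_def)
  have "N \<ge> 2"
    using \<open>m > 0\<close> power_increasing[of 1 m "2::nat"] by (simp add: N_def)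
  \<comment> \<open>Since \<open>q * q = 2 ^ (2 * m + 2)\<close>, \<open>r\<close> is what remains
    after dividing by the field size.\<close>
  define r :: nat where "r = (if n = 2 * m then 4 else 2)"
  have qq: "q * q = CARD('a) * r"
    using assms(2,3) by (auto simp: q_def r_def mult.commute[of 2] power_mult power2_eq_square)
  have frob: "x ^ (q * q) = x ^ r" for x :: 'a
    unfolding qq power_mult by (simp add: power_CARD_eq_self)
  have D_le: "card (D c) \<le> N" for c
  proof (cases "c = 1")
    case False
    have "card (D c) \<le> 2"
      unfolding D_def
      by (rule card_derivative_fibre_le_2[OF char2 q_def _ _ frob False]) (auto simp: r_def)
    thus ?thesis
      using \<open>N \<ge> 2\<close> by simp
  qed (simp add: D1)
  have bound: "FBDT F a c b \<le> N" if "(a, c) \<noteq> (0, 0)" for a c b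
  proof (cases "a = 0")
    \<comment> \<open>Here the derivative vanishes identically while \<open>c \<noteq> 0\<close>, so
      there are no solutions.\<close>
    case True
    thus ?thesis
      using that by (auto simp: FBDT_def add_self_char2[OF char2])
  next
    case False
    have "FBDT F a c b \<le> FBDT F a c 0"
      by (rule FBDT_le_zero_right[OF char2])
    also have "\<dots> = card (D (c / a ^ (q - 1)))"
      unfolding FBDT_zero_right[OF char2] F D_def by (rule card_power_derivative_fibre[OF False])
    also have "\<dots> \<le> N"
      by (rule D_le)
    finally show ?thesis .
  qed
  have "feistel_boomerang_uniformity F = N"
    unfolding feistel_boomerang_uniformity_def
  proof (rule Max_eqI)
    show "finite {FBDT F a c b |a c b. (a, c) \<noteq> (0, 0)}"
      by (rule finite_subset[of _ "{..N}"]) (use bound in auto)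
    \<comment> \<open>The maximum is attained at the exceptional value \<open>c = 1\<close>.\<close>
    have "FBDT F 1 1 0 = N"
      unfolding FBDT_zero_right[OF char2] F using D1 by (simp add: D_def)
    thus "N \<in> {FBDT F a c b |a c b. (a, c) \<noteq> (0, 0)}"
      by force
  qed (use bound in auto)
  thus ?thesis
    by (simp add: N_def)
qed

end
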